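(* Let $(A,\{\cdot,\cdot\},\mu)$ be a Poisson algebra, let $V$ be a left Poisson $A$-module with structure maps $\lambda$ (module action) and $\rho$ (bracket action), let $\alpha,\beta$ be commuting endomorphisms of the Poisson algebra $A$, and let $\phi,\psi$ be commuting linear self-maps of $V$ such that $\phi\circ\lambda=\lambda\circ(\alpha\otimes\phi)$, $\phi\circ\rho=\rho\circ(\alpha\otimes\phi)$, $\psi\circ\lambda=\lambda\circ(\beta\otimes\psi)$ and $\psi\circ\rho=\rho\circ(\beta\otimes\psi)$. Write $A_{\alpha,\beta}$ for the BiHom-Poisson algebra $(A,\{\cdot,\cdot\}_{\alpha,\beta}=\{\cdot,\cdot\}\circ(\alpha\otimes\beta),\mu_{\alpha,\beta}=\mu\circ(\alpha\otimes\beta),\alpha,\beta)$ and $V_{\phi,\psi}$ for the BiHom-module $(V,\phi,\psi)$. Then the maps $$\tilde\lambda=\lambda\circ(\alpha\beta\otimes\psi)\quad\text{and}\quad\tilde\rho=\rho\circ(\alpha\beta\otimes\psi)$$ give the BiHom-module $V_{\phi,\psi}$ the structure of a left BiHom-Poisson $A_{\alpha,\beta}$-module.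
   Context: All vector spaces are over an algebraically closed field $\mathbb{K}$ of characteristic $0$. A Poisson algebra $(A,\{\cdot,\cdot\},\mu)$ is a commutative associative algebra $(A,\mu)$ with a Lie bracket $\{\cdot,\cdot\}$ satisfying $\{\mu(x,y),z\}=\mu(\{x,z\},y)+\mu(x,\{y,z\})$; an endomorphism is a linear map preserving both operations. A left Poisson $A$-module is a vector space $V$ with bilinear maps $\lambda,\rho:A\times V\to V$ such that for $a,b\in A$, $v\in V$: $\lambda(a,\lambda(b,v))=\lambda(\mu(a,b),v)$; $\rho(\{a,b\},v)=\rho(a,\rho(b,v))-\rho(b,\rho(a,v))$; $\rho(a,\lambda(b,v))=\lambda(\{a,b\},v)+\lambda(b,\rho(a,v))$; $\rho(\mu(a,b),v)=\lambda(a,\rho(b,v))+\lambda(b,\rho(a,v))$. A BiHom-Poisson algebra is a tuple $(A,\{\cdot,\cdot\},\mu,\alpha,\beta)$ with $A$ a vector space, $\mu,\{\cdot,\cdot\}:A\times A\to A$ bilinear and $\alpha,\beta:A\to A$ linear with $\alpha\beta=\beta\alpha$, such that for all $x,y,z\in A$: (i) $\alpha$ and $\beta$ are multiplicative for both products; (ii) $\mu(\beta(x),\alpha(y))=\mu(\beta(y),\alpha(x))$; (iii) $\mu(\mu(x,y),\beta(z))=\mu(\alpha(x),\mu(y,z))$; (iv) $\{\beta(x),\alpha(y)\}=-\{\beta(y),\alpha(x)\}$; (v) $\{\beta^2(x),\{\beta(y),\alpha(z)\}\}+\{\beta^2(y),\{\beta(z),\alpha(x)\}\}+\{\beta^2(z),\{\beta(x),\alpha(y)\}\}=0$;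 (vi) $\{\alpha\beta(x),\mu(y,z)\}=\mu(\{\beta(x),y\},\beta(z))+\mu(\beta(y),\{\alpha(x),z\})$. A BiHom-module is $(V,\phi,\psi)$ with $\phi,\psi:V\to V$ commuting linear maps. A left BiHom-Poisson module over a BiHom-Poisson algebra $(A,\{\cdot,\cdot\},\mu,\alpha,\beta)$ is a BiHom-module $(V,\phi,\psi)$ with structure maps, i.e. bilinear maps $\lambda,\rho:A\times V\to V$ that are morphisms of BiHom-modules ($\phi(\lambda(x,v))=\lambda(\alpha(x),\phi(v))$, $\psi(\lambda(x,v))=\lambda(\beta(x),\psi(v))$, and likewise for $\rho$), such that for all $x,y\in A$, $v\in V$: $\lambda(\alpha(x),\lambda(y,v))=\lambda(\mu(x,y),\psi(v))$; $\rho(\{\beta(x),y\},\psi(v))=\rho(\alpha\beta(x),\rho(y,v))-\rho(\beta(y),\rho(\alpha(x),v))$; $\rho(\alpha\beta(x),\lambda(y,v))=\lambda(\{\beta(x),y\},\psi(v))+\lambda(\beta(y),\rho(\alpha(x),v))$; $\rho(\mu(\beta(x),y),\psi(v))=\lambda(\alpha\beta(x),\rho(y,v))+\lambda(\beta(y),\rho(\alpha(x),v))$. *)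

theory Defs
  imports "HOL-Computational_Algebra.Polynomial"
begin

text \<open>Vector spaces are given by a scalar multiplication satisfying the library locale
  \<^locale>\<open>vector_space\<close>, the ground field being an algebraically closed field of characteristic 0.\<close>

definition bilinear_map ::
  "('k::{alg_closed_field, field_char_0} \<Rightarrow> 'a::ab_group_add \<Rightarrow> 'a) \<Rightarrow>
   ('k \<Rightarrow> 'b::ab_group_add \<Rightarrow> 'b) \<Rightarrow> ('k \<Rightarrow> 'c::ab_group_add \<Rightarrow> 'c) \<Rightarrow>
   ('a \<Rightarrow> 'b \<Rightarrow> 'c) \<Rightarrow> bool" where
  "bilinear_map sA sB sC f \<longleftrightarrow>
     (\<forall>y. Vector_Spaces.linear sA sC (\<lambda>x. f x y)) \<and> (\<forall>x. Vector_Spaces.linear sB sC (f x))"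

text \<open>For a curried bilinear map \<open>m\<close>, this is \<open>m \<circ> (f \<otimes> g)\<close>.\<close>

definition twist :: "('a \<Rightarrow> 'b \<Rightarrow> 'c) \<Rightarrow> ('d \<Rightarrow> 'a) \<Rightarrow> ('e \<Rightarrow> 'b) \<Rightarrow> 'd \<Rightarrow> 'e \<Rightarrow> 'c" where
  "twist m f g = (\<lambda>x y. m (f x) (g y))"

text \<open>No unit is required of the associative product.\<close>

locale poisson_algebra = vector_space sA
  for sA :: "'k::{alg_closed_field, field_char_0} \<Rightarrow> 'a::ab_group_add \<Rightarrow> 'a" +
  fixes br :: "'a \<Rightarrow> 'a \<Rightarrow> 'a"
    and \<mu> :: "'a \<Rightarrow> 'a \<Rightarrow> 'a"
  assumes mu_bilinear: "bilinear_map sA sA sA \<mu>"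
    and mu_assoc: "\<mu> (\<mu> x y) z = \<mu> x (\<mu> y z)"
    and mu_commute: "\<mu> x y = \<mu> y x"
    and br_bilinear: "bilinear_map sA sA sA br"
    and br_alternating: "br x x = 0"
    and br_jacobi: "br x (br y z) + br y (br z x) + br z (br x y) = 0"
    and leibniz: "br (\<mu> x y) z = \<mu> (br x z) y + \<mu> x (br y z)"

locale poisson_endomorphism = poisson_algebra sA br \<mu>
  for sA :: "'k::{alg_closed_field, field_char_0} \<Rightarrow> 'a::ab_group_add \<Rightarrow> 'a"
    and br :: "'a \<Rightarrow> 'a \<Rightarrow> 'a"
    and \<mu> :: "'a \<Rightarrow> 'a \<Rightarrow> 'a" +
  fixes f :: "'a \<Rightarrow> 'a"
  assumes endo_linear: "Vector_Spaces.linear sA sA f"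
    and endo_br: "f (br x y) = br (f x) (f y)"
    and endo_mu: "f (\<mu> x y) = \<mu> (f x) (f y)"

text \<open>Below, \<open>l\<close> is the module action and \<open>\<rho>\<close> the bracket action.\<close>

locale left_poisson_module = poisson_algebra sA br \<mu> + V: vector_space sV
  for sA :: "'k::{alg_closed_field, field_char_0} \<Rightarrow> 'a::ab_group_add \<Rightarrow> 'a"
    and br :: "'a \<Rightarrow> 'a \<Rightarrow> 'a"
    and \<mu> :: "'a \<Rightarrow> 'a \<Rightarrow> 'a"
    and sV :: "'k \<Rightarrow> 'v::ab_group_add \<Rightarrow> 'v" +
  fixes l :: "'a \<Rightarrow> 'v \<Rightarrow> 'v"
    and \<rho> :: "'a \<Rightarrow> 'v \<Rightarrow> 'v"
  assumes l_bilinear: "bilinear_map sA sV sV l"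
    and rho_bilinear: "bilinear_map sA sV sV \<rho>"
    and l_l: "l a (l b v) = l (\<mu> a b) v"
    and rho_br: "\<rho> (br a b) v = \<rho> a (\<rho> b v) - \<rho> b (\<rho> a v)"
    and rho_l: "\<rho> a (l b v) = l (br a b) v + l b (\<rho> a v)"
    and rho_mu: "\<rho> (\<mu> a b) v = l a (\<rho> b v) + l b (\<rho> a v)"

locale bihom_poisson_algebra = vector_space sA
  for sA :: "'k::{alg_closed_field, field_char_0} \<Rightarrow> 'a::ab_group_add \<Rightarrow> 'a" +
  fixes br :: "'a \<Rightarrow> 'a \<Rightarrow> 'a"
    and \<mu> :: "'a \<Rightarrow> 'a \<Rightarrow> 'a"
    and \<alpha> :: "'a \<Rightarrow> 'a"
    and \<beta> :: "'a \<Rightarrow> 'a"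
  assumes bh_mu_bilinear: "bilinear_map sA sA sA \<mu>"
    and bh_br_bilinear: "bilinear_map sA sA sA br"
    and alpha_linear: "Vector_Spaces.linear sA sA \<alpha>"
    and beta_linear: "Vector_Spaces.linear sA sA \<beta>"
    and alpha_beta_commute: "\<alpha> \<circ> \<beta> = \<beta> \<circ> \<alpha>"
    and alpha_mu: "\<alpha> (\<mu> x y) = \<mu> (\<alpha> x) (\<alpha> y)"
    and beta_mu: "\<beta> (\<mu> x y) = \<mu> (\<beta> x) (\<beta> y)"
    and alpha_br: "\<alpha> (br x y) = br (\<alpha> x) (\<alpha> y)"
    and beta_br: "\<beta> (br x y) = br (\<beta> x) (\<beta> y)"
    and bh_mu_commute: "\<mu> (\<beta> x) (\<alpha> y) = \<mu> (\<beta> y) (\<alpha> x)"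
    and bh_mu_assoc: "\<mu> (\<mu> x y) (\<beta> z) = \<mu> (\<alpha> x) (\<mu> y z)"
    and bh_br_skew: "br (\<beta> x) (\<alpha> y) = - br (\<beta> y) (\<alpha> x)"
    and bh_br_jacobi:
      "br (\<beta> (\<beta> x)) (br (\<beta> y) (\<alpha> z)) + br (\<beta> (\<beta> y)) (br (\<beta> z) (\<alpha> x))
         + br (\<beta> (\<beta> z)) (br (\<beta> x) (\<alpha> y)) = 0"
    and bh_leibniz:
      "br (\<alpha> (\<beta> x)) (\<mu> y z) = \<mu> (br (\<beta> x) y) (\<beta> z) + \<mu> (\<beta> y) (br (\<alpha> x) z)"

locale bihom_module = vector_space sV
  for sV :: "'k::{alg_closed_field, field_char_0} \<Rightarrow> 'v::ab_group_add \<Rightarrow> 'v" +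
  fixes \<phi> :: "'v \<Rightarrow> 'v"
    and \<psi> :: "'v \<Rightarrow> 'v"
  assumes phi_linear: "Vector_Spaces.linear sV sV \<phi>"
    and psi_linear: "Vector_Spaces.linear sV sV \<psi>"
    and phi_psi_commute: "\<phi> \<circ> \<psi> = \<psi> \<circ> \<phi>"

locale left_bihom_poisson_module =
  bihom_poisson_algebra sA br \<mu> \<alpha> \<beta> + V: bihom_module sV \<phi> \<psi>
  for sA :: "'k::{alg_closed_field, field_char_0} \<Rightarrow> 'a::ab_group_add \<Rightarrow> 'a"
    and br :: "'a \<Rightarrow> 'a \<Rightarrow> 'a"
    and \<mu> :: "'a \<Rightarrow> 'a \<Rightarrow> 'a"
    and \<alpha> :: "'a \<Rightarrow> 'a"
    and \<beta> :: "'a \<Rightarrow> 'a"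
    and sV :: "'k \<Rightarrow> 'v::ab_group_add \<Rightarrow> 'v"
    and \<phi> :: "'v \<Rightarrow> 'v"
    and \<psi> :: "'v \<Rightarrow> 'v" +
  fixes l :: "'a \<Rightarrow> 'v \<Rightarrow> 'v"
    and \<rho> :: "'a \<Rightarrow> 'v \<Rightarrow> 'v"
  assumes bh_l_bilinear: "bilinear_map sA sV sV l"
    and bh_rho_bilinear: "bilinear_map sA sV sV \<rho>"
    and phi_l: "\<phi> (l x v) = l (\<alpha> x) (\<phi> v)"
    and psi_l: "\<psi> (l x v) = l (\<beta> x) (\<psi> v)"
    and phi_rho: "\<phi> (\<rho> x v) = \<rho> (\<alpha> x) (\<phi> v)"
    and psi_rho: "\<psi> (\<rho> x v) = \<rho> (\<beta> x) (\<psi> v)"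
    and bh_l_l: "l (\<alpha> x) (l y v) = l (\<mu> x y) (\<psi> v)"
    and bh_rho_br:
      "\<rho> (br (\<beta> x) y) (\<psi> v) = \<rho> (\<alpha> (\<beta> x)) (\<rho> y v) - \<rho> (\<beta> y) (\<rho> (\<alpha> x) v)"
    and bh_rho_l:
      "\<rho> (\<alpha> (\<beta> x)) (l y v) = l (br (\<beta> x) y) (\<psi> v) + l (\<beta> y) (\<rho> (\<alpha> x) v)"
    and bh_rho_mu:
      "\<rho> (\<mu> (\<beta> x) y) (\<psi> v) = l (\<alpha> (\<beta> x)) (\<rho> y v) + l (\<beta> y) (\<rho> (\<alpha> x) v)"

end

theory Submission
  imports Defs
begin

text \<open>
  This is the Yau twisting principle. Put \<open>X = \<alpha>\<^sup>2\<beta>\<^sup>2(x)\<close>, \<open>Y = \<alpha>\<beta>\<^sup>2(y)\<close> and \<open>W = \<psi>\<^sup>2(v)\<close>. Since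
  \<open>\<alpha>\<close> and \<open>\<beta>\<close> commute and respect both products, and \<open>\<psi>\<close> intertwines the actions of \<open>a\<close> and
  \<open>\<beta>(a)\<close>, every twisting map can be pushed inwards to the arguments. The BiHom-axioms are
  arranged so that each variable then carries the same composite of twisting maps in every term
  of an identity: the three module identities for \<open>\<rho>\<close> become the ordinary Poisson
  module identities at \<open>X\<close>, \<open>Y\<close>, \<open>W\<close>, and the associativity identity becomes the ordinary one at
  \<open>\<alpha>\<^sup>2\<beta>(x)\<close>, \<open>Y\<close>, \<open>W\<close>. The algebra identities are handled in the same way.

  Two points need more than pushing maps inwards. The BiHom-Leibniz rule differentiates the
  second argument of the bracket whereas the rule of a Poisson algebra differentiates the first,
  so antisymmetry must be used. Bilinearity survives because the twisting maps are linear.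
\<close>

lemma bilinear_map_twist:
  assumes bil: "bilinear_map sA sB sC m"
    and f: "Vector_Spaces.linear sD sA f"
    and g: "Vector_Spaces.linear sE sB g"
  shows "bilinear_map sD sE sC (twist m f g)"
proof -
  have left: "Vector_Spaces.linear sD sC (\<lambda>x. m (f x) (g y))" for y
    using Vector_Spaces.linear_compose[OF f, of sC "\<lambda>x. m x (g y)"] bil
    by (simp add: bilinear_map_def o_def)
  have right: "Vector_Spaces.linear sE sC (\<lambda>y. m (f x) (g y))" for x
    using Vector_Spaces.linear_compose[OF g, of sC "m (f x)"] bil
    by (simp add: bilinear_map_def o_def)
  show ?thesis
    using left right by (simp add: bilinear_map_def twist_def)
qed

lemma bilinear_map_add:
  assumes "bilinear_map sA sB sC m"
  shows bilinear_map_add_left: "m (x + x') y = m x y + m x' y"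
    and bilinear_map_add_right: "m x (y + y') = m x y + m x y'"
proof -
  have "Vector_Spaces.linear sA sC (\<lambda>x. m x y)" and "Vector_Spaces.linear sB sC (m x)"
    using assms by (simp_all add: bilinear_map_def)
  then show "m (x + x') y = m x y + m x' y" and "m x (y + y') = m x y + m x y'"
    by (simp_all add: Vector_Spaces.linear_iff)
qed

lemma bilinear_map_minus_left:
  assumes "bilinear_map sA sB sC m"
  shows "m (- x) y = - m x y"
proof -
  have "m 0 y = 0"
    using bilinear_map_add_left[OF assms, of 0 0 y] by simp
  then have "m (- x) y + m x y = 0"
    using bilinear_map_add_left[OF assms, of "- x" x y] by simp
  then show ?thesis
    by (simp add: eq_neg_iff_add_eq_0)
qed

context poisson_algebra
begin

text \<open>Polarisation: expand \<open>br (x + y) (x + y) = 0\<close>.\<close>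

lemma br_skew: "br x y = - br y x"
proof -
  have "br x y + br y x = br (x + y) (x + y)"
    by (simp add: bilinear_map_add[OF br_bilinear] br_alternating[of x] br_alternating[of y])
  also have "\<dots> = 0"
    by (rule br_alternating)
  finally show ?thesis
    by (simp add: eq_neg_iff_add_eq_0)
qed

text \<open>Reversing the three brackets in the Leibniz rule changes the sign of every term.\<close>

lemma leibniz_right: "br x (\<mu> y z) = \<mu> (br x y) z + \<mu> y (br x z)"
proof -
  have "br x (\<mu> y z) = - (\<mu> (br y x) z + \<mu> (br z x) y)"
    by (subst br_skew) (simp add: leibniz mu_commute[of y "br z x"])
  also have "\<dots> = \<mu> (br x y) z + \<mu> (br x z) y"
    using br_skew[of y x] br_skew[of z x]
    by (simp add: bilinear_map_minus_left[OF mu_bilinear])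
  finally show ?thesis
    by (simp add: mu_commute[of y "br x z"])
qed

end

text \<open>
  The composite in front of each variable is the same throughout each identity: for
  associativity \<open>\<alpha>\<^sup>2\<close>, \<open>\<alpha>\<beta>\<close>, \<open>\<beta>\<^sup>2\<close> on \<open>x\<close>, \<open>y\<close>, \<open>z\<close>; for the Jacobi identity \<open>\<alpha>\<beta>\<^sup>2\<close> on all three; for the
  Leibniz rule \<open>\<alpha>\<^sup>2\<beta>\<close>, \<open>\<alpha>\<beta>\<close>, \<open>\<beta>\<^sup>2\<close>.
\<close>

lemma bihom_poisson_algebra_twist:
  assumes \<alpha>: "poisson_endomorphism sA br \<mu> \<alpha>"
    and \<beta>: "poisson_endomorphism sA br \<mu> \<beta>"
    and comm: "\<alpha> \<circ> \<beta> = \<beta> \<circ> \<alpha>"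
  shows "bihom_poisson_algebra sA (twist br \<alpha> \<beta>) (twist \<mu> \<alpha> \<beta>) \<alpha> \<beta>"
proof -
  interpret \<alpha>: poisson_endomorphism sA br \<mu> \<alpha> by (rule \<alpha>)
  interpret \<beta>: poisson_endomorphism sA br \<mu> \<beta> by (rule \<beta>)
  have \<beta>\<alpha>: "\<beta> (\<alpha> x) = \<alpha> (\<beta> x)" for x
    using comm by (simp add: fun_eq_iff)
  \<comment> \<open>These rules move all twisting maps inwards, with every \<open>\<alpha>\<close> to the left of every \<open>\<beta>\<close>.\<close>
  note push = twist_def \<beta>\<alpha> \<alpha>.endo_br \<alpha>.endo_mu \<beta>.endo_br \<beta>.endo_mu
  show ?thesis
  proof (intro bihom_poisson_algebra.intro bihom_poisson_algebra_axioms.intro)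
    show "vector_space sA"
      by (rule \<alpha>.vector_space_axioms)
    show "bilinear_map sA sA sA (twist \<mu> \<alpha> \<beta>)"
      by (rule bilinear_map_twist[OF \<alpha>.mu_bilinear \<alpha>.endo_linear \<beta>.endo_linear])
    show "bilinear_map sA sA sA (twist br \<alpha> \<beta>)"
      by (rule bilinear_map_twist[OF \<alpha>.br_bilinear \<alpha>.endo_linear \<beta>.endo_linear])
    show "Vector_Spaces.linear sA sA \<alpha>" "Vector_Spaces.linear sA sA \<beta>"
      by (rule \<alpha>.endo_linear \<beta>.endo_linear)+
    show "\<alpha> \<circ> \<beta> = \<beta> \<circ> \<alpha>"
      by (rule comm)
    fix x y z
    show "\<alpha> (twist \<mu> \<alpha> \<beta> x y) = twist \<mu> \<alpha> \<beta> (\<alpha> x) (\<alpha> y)"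
      "\<beta> (twist \<mu> \<alpha> \<beta> x y) = twist \<mu> \<alpha> \<beta> (\<beta> x) (\<beta> y)"
      "\<alpha> (twist br \<alpha> \<beta> x y) = twist br \<alpha> \<beta> (\<alpha> x) (\<alpha> y)"
      "\<beta> (twist br \<alpha> \<beta> x y) = twist br \<alpha> \<beta> (\<beta> x) (\<beta> y)"
      by (simp_all add: push)
    show "twist \<mu> \<alpha> \<beta> (\<beta> x) (\<alpha> y) = twist \<mu> \<alpha> \<beta> (\<beta> y) (\<alpha> x)"
      by (simp add: push \<alpha>.mu_commute)
    show "twist \<mu> \<alpha> \<beta> (twist \<mu> \<alpha> \<beta> x y) (\<beta> z) = twist \<mu> \<alpha> \<beta> (\<alpha> x) (twist \<mu> \<alpha> \<beta> y z)"
      by (simp add: push \<alpha>.mu_assoc)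
    show "twist br \<alpha> \<beta> (\<beta> x) (\<alpha> y) = - twist br \<alpha> \<beta> (\<beta> y) (\<alpha> x)"
      using \<alpha>.br_skew[of "\<alpha> (\<beta> x)" "\<alpha> (\<beta> y)"] by (simp add: push)
    show "twist br \<alpha> \<beta> (\<beta> (\<beta> x)) (twist br \<alpha> \<beta> (\<beta> y) (\<alpha> z))
        + twist br \<alpha> \<beta> (\<beta> (\<beta> y)) (twist br \<alpha> \<beta> (\<beta> z) (\<alpha> x))
        + twist br \<alpha> \<beta> (\<beta> (\<beta> z)) (twist br \<alpha> \<beta> (\<beta> x) (\<alpha> y)) = 0"
      by (simp add: push \<alpha>.br_jacobi)
    show "twist br \<alpha> \<beta> (\<alpha> (\<beta> x)) (twist \<mu> \<alpha> \<beta> y z)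
        = twist \<mu> \<alpha> \<beta> (twist br \<alpha> \<beta> (\<beta> x) y) (\<beta> z)
        + twist \<mu> \<alpha> \<beta> (\<beta> y) (twist br \<alpha> \<beta> (\<alpha> x) z)"
      by (simp add: push \<alpha>.leibniz_right)
  qed
qed

theorem theorem5p13:
  fixes sA :: "'k::{alg_closed_field, field_char_0} \<Rightarrow> 'a::ab_group_add \<Rightarrow> 'a"
    and br :: "'a \<Rightarrow> 'a \<Rightarrow> 'a"
    and \<mu> :: "'a \<Rightarrow> 'a \<Rightarrow> 'a"
    and sV :: "'k \<Rightarrow> 'v::ab_group_add \<Rightarrow> 'v"
    and l :: "'a \<Rightarrow> 'v \<Rightarrow> 'v"
    and \<rho> :: "'a \<Rightarrow> 'v \<Rightarrow> 'v"
    and \<alpha> \<beta> :: "'a \<Rightarrow> 'a"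
    and \<phi> \<psi> :: "'v \<Rightarrow> 'v"
  assumes "poisson_algebra sA br \<mu>"
    and "left_poisson_module sA br \<mu> sV l \<rho>"
    and "poisson_endomorphism sA br \<mu> \<alpha>"
    and "poisson_endomorphism sA br \<mu> \<beta>"
    and "\<alpha> \<circ> \<beta> = \<beta> \<circ> \<alpha>"
    and "Vector_Spaces.linear sV sV \<phi>"
    and "Vector_Spaces.linear sV sV \<psi>"
    and "\<phi> \<circ> \<psi> = \<psi> \<circ> \<phi>"
    and "\<And>x v. \<phi> (l x v) = l (\<alpha> x) (\<phi> v)"
    and "\<And>x v. \<phi> (\<rho> x v) = \<rho> (\<alpha> x) (\<phi> v)"
    and "\<And>x v. \<psi> (l x v) = l (\<beta> x) (\<psi> v)"
    and "\<And>x v. \<psi> (\<rho> x v) = \<rho> (\<beta> x) (\<psi> v)"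
  shows "left_bihom_poisson_module
           sA (twist br \<alpha> \<beta>) (twist \<mu> \<alpha> \<beta>) \<alpha> \<beta>
           sV \<phi> \<psi>
           (twist l (\<alpha> \<circ> \<beta>) \<psi>) (twist \<rho> (\<alpha> \<circ> \<beta>) \<psi>)"
proof -
  interpret left_poisson_module sA br \<mu> sV l \<rho> by (rule assms(2))
  interpret \<alpha>: poisson_endomorphism sA br \<mu> \<alpha> by (rule assms(3))
  interpret \<beta>: poisson_endomorphism sA br \<mu> \<beta> by (rule assms(4))
  have \<beta>\<alpha>: "\<beta> (\<alpha> x) = \<alpha> (\<beta> x)" for x
    using assms(5) by (simp add: fun_eq_iff)
  have \<psi>\<phi>: "\<psi> (\<phi> v) = \<phi> (\<psi> v)" for v
    using assms(8) by (simp add: fun_eq_iff)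
  have \<alpha>\<beta>_linear: "Vector_Spaces.linear sA sA (\<alpha> \<circ> \<beta>)"
    by (rule Vector_Spaces.linear_compose[OF \<beta>.endo_linear \<alpha>.endo_linear])
  note push = twist_def \<beta>\<alpha> \<psi>\<phi> \<alpha>.endo_br \<alpha>.endo_mu \<beta>.endo_br \<beta>.endo_mu assms(9-12)
  show ?thesis
  proof (intro left_bihom_poisson_module.intro left_bihom_poisson_module_axioms.intro
      bihom_module.intro bihom_module_axioms.intro)
    show "bihom_poisson_algebra sA (twist br \<alpha> \<beta>) (twist \<mu> \<alpha> \<beta>) \<alpha> \<beta>"
      using assms(3-5) by (rule bihom_poisson_algebra_twist)
    show "vector_space sV"
      by (rule V.vector_space_axioms)
    show "Vector_Spaces.linear sV sV \<phi>" "Vector_Spaces.linear sV sV \<psi>" "\<phi> \<circ> \<psi> = \<psi> \<circ> \<phi>"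
      by (rule assms(6-8))+
    show "bilinear_map sA sV sV (twist l (\<alpha> \<circ> \<beta>) \<psi>)"
      by (rule bilinear_map_twist[OF l_bilinear \<alpha>\<beta>_linear assms(7)])
    show "bilinear_map sA sV sV (twist \<rho> (\<alpha> \<circ> \<beta>) \<psi>)"
      by (rule bilinear_map_twist[OF rho_bilinear \<alpha>\<beta>_linear assms(7)])
    fix x y v
    let ?br = "twist br \<alpha> \<beta>" and ?\<mu> = "twist \<mu> \<alpha> \<beta>"
      and ?l = "twist l (\<alpha> \<circ> \<beta>) \<psi>" and ?\<rho> = "twist \<rho> (\<alpha> \<circ> \<beta>) \<psi>"
    show "\<phi> (?l x v) = ?l (\<alpha> x) (\<phi> v)" "\<psi> (?l x v) = ?l (\<beta> x) (\<psi> v)"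
      "\<phi> (?\<rho> x v) = ?\<rho> (\<alpha> x) (\<phi> v)" "\<psi> (?\<rho> x v) = ?\<rho> (\<beta> x) (\<psi> v)"
      by (simp_all add: push)
    show "?l (\<alpha> x) (?l y v) = ?l (?\<mu> x y) (\<psi> v)"
      by (simp add: push l_l)
    show "?\<rho> (?br (\<beta> x) y) (\<psi> v) = ?\<rho> (\<alpha> (\<beta> x)) (?\<rho> y v) - ?\<rho> (\<beta> y) (?\<rho> (\<alpha> x) v)"
      by (simp add: push rho_br)
    show "?\<rho> (\<alpha> (\<beta> x)) (?l y v) = ?l (?br (\<beta> x) y) (\<psi> v) + ?l (\<beta> y) (?\<rho> (\<alpha> x) v)"
      by (simp add: push rho_l)
    show "?\<rho> (?\<mu> (\<beta> x) y) (\<psi> v) = ?l (\<alpha> (\<beta> x)) (?\<rho> y v) + ?l (\<beta> y) (?\<rho> (\<alpha> x) v)"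
      by (simp add: push rho_mu)
  qed
qed

end
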